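(* Let $\xi'=\sum_{i\ge 0}\sum_{j=1}^{L'_i}\delta_{T'_i+T'_{ij}}$ be a renewal cluster point process with increments $X'_i$, $\mu=\mathbb{E}X'_1$, and $R'_i=\sup_{j\le L'_i}|T'_{ij}|$. Suppose that $L'_0$, $L'_1$, $L'_1X'_1$ and $L'_1R'_1$ all have finite mean. Then $$\frac{\mathbb{E}\,\xi'(0,t]}{t}\ \longrightarrow\ \frac1\mu\,\mathbb{E}L'_1\qquad\text{as } t\to\infty.$$
   Context: Notation: $\mathbb{R}_+=[0,\infty)$; $M_p(\mathbb{R})$ is the space of point measures on $\mathbb{R}$ finite on all bounded sets. A nonnegative random variable is nonarithmetic if its law is not concentrated on $h\mathbb{Z}$ for any $h>0$. Renewal cluster point process $\xi'$: let $(X'_i)_{i\ge1}$ be nonnegative random variables with a nonarithmetic distribution and finite mean $\mu>0$, and let $\xi'_i$, $i\ge 1$, be point processes on $\mathbb{R}$ such that the pairs $W'_i=(\xi'_i,X'_i)$, $i\ge1$, are i.i.d. ($\xi'_i$ and $X'_i$ may be dependent). Let $W'_0=(\xi'_0,X'_0)$ be a random element of $M_p(\mathbb{R})\times\mathbb{R}_+$ independent of $(W'_i)_{i\ge1}$ (its law may differ from that of $W'_1$). Each $\xi'_i=\sum_{j=1}^{L'_i}\delta_{T'_{ij}}$, where $L'_i$ is an $\mathbb{N}_0$-valued random variable, assumed almost surely finite for every $i\ge0$, and $T'_{i1},T'_{i2},\ldots$ are real random variables; $W'_i$ is identified with $(L'_i,(T'_{ij})_j,X'_i)$, a random element of $\mathbb{N}_0\times\mathbb{R}^{\mathbb{N}}\times\mathbb{R}_+$.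 Put $T'_i=\sum_{j=0}^iX'_j$, $i\ge0$, and $\xi'(B)=\sum_{i\ge0}\xi'_i(B-T'_i)=\sum_{i\ge0}\sum_{j=1}^{L'_i}\delta_{T'_i+T'_{ij}}(B)$ for Borel $B\subseteq\mathbb{R}$; it is assumed throughout that almost surely $\xi'(B)<\infty$ for all bounded Borel $B$. Here $R'_i=\sup_{j\le L'_i}|T'_{ij}|\in[0,\infty)$, $i\ge0$, with $R'_i=0$ if $L'_i=0$. *)

theory Defs
  imports "HOL-Probability.Probability"
begin

definition nonarithmetic :: "real measure \<Rightarrow> bool" where
  "nonarithmetic N \<longleftrightarrow>
     (\<forall>h>0. \<not> (AE x in N. x \<in> range (\<lambda>k::int. h * real_of_int k)))"

text \<open>
  The cluster of index \<open>i\<close> has \<open>L i\<close> points, located (before the shift) at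
  \<open>T i 1, \<dots>, T i (L i)\<close>.  The value \<open>T i 0\<close> plays no role, so the mark of the cluster,
  a random element of \<open>\<nat>\<^sub>0 \<times> \<real>\<^sup>\<nat> \<times> \<real>\<^sub>+\<close>, only records the indices \<open>j \<ge> 1\<close>.
\<close>

definition mark_space :: "(nat \<times> (nat \<Rightarrow> real) \<times> real) measure" where
  "mark_space =
     count_space UNIV \<Otimes>\<^sub>M (PiM {1..} (\<lambda>_. borel) \<Otimes>\<^sub>M borel)"

definition cluster_mark ::
  "(nat \<Rightarrow> 'a \<Rightarrow> nat) \<Rightarrow> (nat \<Rightarrow> nat \<Rightarrow> 'a \<Rightarrow> real) \<Rightarrow> (nat \<Rightarrow> 'a \<Rightarrow> real)
    \<Rightarrow> nat \<Rightarrow> 'a \<Rightarrow> nat \<times> (nat \<Rightarrow> real) \<times> real" where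
  "cluster_mark L T X i \<omega> = (L i \<omega>, (\<lambda>j\<in>{1..}. T i j \<omega>), X i \<omega>)"

definition renewal_epoch :: "(nat \<Rightarrow> 'a \<Rightarrow> real) \<Rightarrow> nat \<Rightarrow> 'a \<Rightarrow> real" where
  "renewal_epoch X i \<omega> = (\<Sum>j=0..i. X j \<omega>)"

definition cluster_radius ::
  "(nat \<Rightarrow> 'a \<Rightarrow> nat) \<Rightarrow> (nat \<Rightarrow> nat \<Rightarrow> 'a \<Rightarrow> real) \<Rightarrow> nat \<Rightarrow> 'a \<Rightarrow> real" where
  "cluster_radius L T i \<omega> =
     (if L i \<omega> = 0 then 0 else (SUP j\<in>{1..L i \<omega>}. \<bar>T i j \<omega>\<bar>))"

text \<open>The (possibly infinite) number of points in \<open>B\<close>; \<open>indicator B x\<close> is \<open>\<delta>\<^sub>x(B)\<close>.\<close>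

definition cluster_process ::
  "(nat \<Rightarrow> 'a \<Rightarrow> nat) \<Rightarrow> (nat \<Rightarrow> nat \<Rightarrow> 'a \<Rightarrow> real) \<Rightarrow> (nat \<Rightarrow> 'a \<Rightarrow> real)
    \<Rightarrow> 'a \<Rightarrow> real set \<Rightarrow> ennreal" where
  "cluster_process L T X \<omega> B =
     (\<Sum>i. \<Sum>j=1..L i \<omega>. indicator B (renewal_epoch X i \<omega> + T i j \<omega>))"

text \<open>
  Independence of the whole family of marks, index \<open>0\<close> included, says that the marks of index
  \<open>i \<ge> 1\<close> are independent and that the mark of index \<open>0\<close> is independent of all of them; its law
  is unrestricted.  Within one mark, the components may be dependent.
\<close>

locale renewal_cluster_process = prob_space M for M :: "'a measure" +
  fixes L :: "nat \<Rightarrow> 'a \<Rightarrow> nat"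
    and T :: "nat \<Rightarrow> nat \<Rightarrow> 'a \<Rightarrow> real"
    and X :: "nat \<Rightarrow> 'a \<Rightarrow> real"
  assumes indep_marks: "indep_vars (\<lambda>_. mark_space) (cluster_mark L T X) UNIV"
    and ident_marks:
      "\<And>i. i \<ge> 1 \<Longrightarrow>
         distr M mark_space (cluster_mark L T X i) = distr M mark_space (cluster_mark L T X 1)"
    and X_nonneg: "\<And>i \<omega>. \<omega> \<in> space M \<Longrightarrow> X i \<omega> \<ge> 0"
    and X_nonarithmetic: "nonarithmetic (distr M borel (X 1))"
    and X_integrable: "integrable M (X 1)"
    and X_mean_pos: "expectation (X 1) > 0"
    and locally_finite:
      "AE \<omega> in M. \<forall>B\<in>sets borel. bounded B \<longrightarrow> cluster_process L T X \<omega> B < \<infinity>"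

end

theory Submission imports Defs begin

text \<open>
  Split off the cluster of index \<open>0\<close>: it contributes at most \<open>L 0\<close> points, whose finite mean
  vanishes after division by \<open>t\<close>.  The cluster of index \<open>i \<ge> 1\<close> is placed at
  \<open>S\<^sub>i = S\<^bsub>i-1\<^esub> + X\<^sub>i\<close>, and \<open>S\<^bsub>i-1\<^esub>\<close> is independent of the whole mark \<open>(L\<^sub>i, T\<^sub>i, X\<^sub>i)\<close>, whose
  law is that of the mark of index \<open>1\<close>.  Freeze that mark, with points at \<open>a\<^sub>j = X\<^sub>1 + T\<^bsub>1j\<^esub>\<close>
  relative to \<open>S\<^bsub>i-1\<^esub>\<close>, and sum over \<open>i\<close>: with \<open>U(t)\<close> the sum over \<open>n \<ge> 0\<close> of
  \<open>P(S\<^sub>n \<le> t)\<close>, the expected number of points of later clusters in \<open>(0,t]\<close> is the mean of the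
  sum over \<open>j \<le> L\<^sub>1\<close> of \<open>U(t - a\<^sub>j) - U(-a\<^sub>j)\<close>
  (\<open>nn_integral_later_clusters\<close>).

  By the elementary renewal theorem \<open>U(t)/t \<rightarrow> 1/\<mu>\<close>, each summand divided by \<open>t\<close> tends to
  \<open>1/\<mu>\<close>.  Since \<open>U\<close> grows at most linearly, the sum divided by \<open>t \<ge> 1\<close> is at most a constant
  times \<open>L\<^sub>1 (2 + X\<^sub>1 + R\<^sub>1)\<close> (\<open>window_sum_le\<close>), which is where the means of \<open>L\<^sub>1\<close>, \<open>L\<^sub>1 X\<^sub>1\<close> and
  \<open>L\<^sub>1 R\<^sub>1\<close> enter, and dominated convergence gives the limit \<open>E L\<^sub>1 / \<mu>\<close>.

  The renewal theorem itself comes from telescoping \<open>min c S\<^sub>n\<close>.  An increment is at most \<open>X\<^bsub>n+1\<^esub>\<close> on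
  \<open>S\<^sub>n \<le> c\<close> and vanishes otherwise, so that \<open>\<mu> U(c) \<ge> c - E (min c S\<^sub>0)\<close>; it is at least
  \<open>min X\<^bsub>n+1\<^esub> b\<close> on \<open>S\<^sub>n \<le> c - b\<close>, so that \<open>E (min X\<^sub>1 b) U(c - b) \<le> c\<close>.  Let \<open>c \<rightarrow> \<infinity>\<close>,
  then \<open>b \<rightarrow> \<infinity>\<close>.
\<close>

section \<open>The elementary renewal theorem\<close>

locale delayed_renewal_sequence = prob_space M for M :: "'a measure" +
  fixes X :: "nat \<Rightarrow> 'a \<Rightarrow> real"
  assumes indep_steps: "indep_vars (\<lambda>_. borel) X UNIV"
    and ident_steps: "\<And>i. i \<ge> 1 \<Longrightarrow> distr M borel (X i) = distr M borel (X 1)"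
    and step_nonneg: "\<And>i \<omega>. \<omega> \<in> space M \<Longrightarrow> X i \<omega> \<ge> 0"
    and step_integrable: "integrable M (X 1)"
    and step_mean_pos: "expectation (X 1) > 0"
begin

abbreviation S :: "nat \<Rightarrow> 'a \<Rightarrow> real" where
  "S \<equiv> renewal_epoch X"

definition renewal_function :: "real \<Rightarrow> real" where
  "renewal_function t = (\<Sum>n. prob {\<omega> \<in> space M. S n \<omega> \<le> t})"

definition truncated_mean :: "real \<Rightarrow> real" where
  "truncated_mean b = expectation (\<lambda>\<omega>. min (X 1 \<omega>) b)"

lemma step_measurable [measurable]: "X i \<in> borel_measurable M"
  using indep_steps by (auto simp: indep_vars_def)

lemma epoch_measurable [measurable]: "S n \<in> borel_measurable M"
  unfolding renewal_epoch_def [abs_def] by measurable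

lemma epoch_Suc: "S (Suc n) \<omega> = S n \<omega> + X (Suc n) \<omega>"
  by (simp add: renewal_epoch_def)

lemma epoch_nonneg: "\<omega> \<in> space M \<Longrightarrow> S n \<omega> \<ge> 0"
  by (auto simp: renewal_epoch_def intro!: sum_nonneg step_nonneg)

text \<open>
  Membership of \<open>S n\<close> in a fixed set is decided before the step \<open>X (Suc n)\<close> is drawn; this is the
  only form in which independence of the steps enters the renewal theorem.
\<close>

lemma indep_epoch_step: "indep_var borel (S n) borel (X (Suc n))"
proof -
  have "indep_var
      borel ((\<lambda>x. \<Sum>j=0..n. x j) \<circ> (\<lambda>\<omega>. restrict (\<lambda>i. X i \<omega>) {0..n}))
      borel ((\<lambda>x. x (Suc n)) \<circ> (\<lambda>\<omega>. restrict (\<lambda>i. X i \<omega>) {Suc n}))"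
    by (rule indep_var_compose, rule indep_var_restrict [OF indep_steps]) auto
  also have "(\<lambda>x. \<Sum>j=0..n. x j) \<circ> (\<lambda>\<omega>. restrict (\<lambda>i. X i \<omega>) {0..n}) = S n"
    by (auto simp: fun_eq_iff renewal_epoch_def intro!: sum.cong)
  also have "(\<lambda>x. x (Suc n)) \<circ> (\<lambda>\<omega>. restrict (\<lambda>i. X i \<omega>) {Suc n}) = X (Suc n)"
    by (auto simp: fun_eq_iff)
  finally show ?thesis .
qed

lemma
  assumes [measurable]: "f \<in> borel_measurable borel"
    and int: "integrable M (\<lambda>\<omega>. f (X 1 \<omega>))"
  shows integrable_step_before:
      "integrable M (\<lambda>\<omega>. indicat_real {..t} (S n \<omega>) * f (X (Suc n) \<omega>))"
    and expectation_step_before: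
      "expectation (\<lambda>\<omega>. indicat_real {..t} (S n \<omega>) * f (X (Suc n) \<omega>)) =
       prob {\<omega> \<in> space M. S n \<omega> \<le> t} * expectation (\<lambda>\<omega>. f (X 1 \<omega>))"
proof -
  have ident: "distr M borel (X (Suc n)) = distr M borel (X 1)"
    by (rule ident_steps) simp
  have "integrable (distr M borel (X 1)) f"
    using int by (simp add: integrable_distr_eq)
  then have 1: "integrable M (\<lambda>\<omega>. f (X (Suc n) \<omega>))"
    by (subst (asm) ident [symmetric]) (simp add: integrable_distr_eq)
  have "expectation (\<lambda>\<omega>. f (X (Suc n) \<omega>)) = (\<integral>x. f x \<partial>distr M borel (X (Suc n)))"
    by (simp add: integral_distr)
  then have 2: "expectation (\<lambda>\<omega>. f (X (Suc n) \<omega>)) = expectation (\<lambda>\<omega>. f (X 1 \<omega>))"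
    by (simp add: ident integral_distr)
  have 3: "integrable M (\<lambda>\<omega>. indicat_real {..t} (S n \<omega>))"
    by (rule integrable_const_bound [where B = 1]) auto
  have 4: "indep_var borel (\<lambda>\<omega>. indicat_real {..t} (S n \<omega>)) borel (\<lambda>\<omega>. f (X (Suc n) \<omega>))"
    using indep_var_compose [OF indep_epoch_step [of n], of "indicat_real {..t}" borel f borel]
    by (simp add: comp_def)
  have "expectation (\<lambda>\<omega>. indicat_real {..t} (S n \<omega>)) =
      expectation (indicator {\<omega> \<in> space M. S n \<omega> \<le> t})"
    by (rule Bochner_Integration.integral_cong) (auto simp: indicator_def)
  also have "\<dots> = prob {\<omega> \<in> space M. S n \<omega> \<le> t}"
    by (auto intro!: arg_cong [where f = prob])
  finally have 5: "expectation (\<lambda>\<omega>. indicat_real {..t} (S n \<omega>)) = \<dots>" .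
  show "integrable M (\<lambda>\<omega>. indicat_real {..t} (S n \<omega>) * f (X (Suc n) \<omega>))"
    by (rule indep_var_integrable [OF 4 3 1])
  show "expectation (\<lambda>\<omega>. indicat_real {..t} (S n \<omega>) * f (X (Suc n) \<omega>)) =
       prob {\<omega> \<in> space M. S n \<omega> \<le> t} * expectation (\<lambda>\<omega>. f (X 1 \<omega>))"
    using indep_var_lebesgue_integral [OF 4 3 1] 2 5 by simp
qed

lemma integrable_truncated_step: "b \<ge> 0 \<Longrightarrow> integrable M (\<lambda>\<omega>. min (X i \<omega>) b)"
  by (rule integrable_const_bound [where B = b]) (auto simp: step_nonneg)

lemma integrable_truncated_epoch: "c \<ge> 0 \<Longrightarrow> integrable M (\<lambda>\<omega>. min c (S n \<omega>))"
  by (rule integrable_const_bound [where B = c]) (auto simp: epoch_nonneg)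

lemma truncated_mean_tendsto: "(truncated_mean \<longlongrightarrow> expectation (X 1)) at_top"
  unfolding truncated_mean_def [abs_def]
proof (rule integral_dominated_convergence_at_top [where w = "X 1"])
  show "AE \<omega> in M. ((\<lambda>b. min (X 1 \<omega>) b) \<longlongrightarrow> X 1 \<omega>) at_top"
  proof (intro AE_I2 tendsto_eventually)
    fix \<omega>
    show "\<forall>\<^sub>F b in at_top. min (X 1 \<omega>) b = X 1 \<omega>"
      using eventually_ge_at_top [of "X 1 \<omega>"] by eventually_elim simp
  qed
  show "\<forall>\<^sub>F b in at_top. AE \<omega> in M. norm (min (X 1 \<omega>) b) \<le> X 1 \<omega>"
    using eventually_ge_at_top [of 0] by eventually_elim (auto simp: step_nonneg)
qed (use step_integrable in auto)

lemma truncated_mean_pos: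
  assumes "b > 0"
  shows "truncated_mean b > 0"
proof -
  have "truncated_mean b \<ge> 0"
    unfolding truncated_mean_def using assms
    by (intro integral_nonneg_AE) (auto simp: step_nonneg)
  moreover have "truncated_mean b \<noteq> 0"
  proof
    assume "truncated_mean b = 0"
    then have "AE \<omega> in M. min (X 1 \<omega>) b = 0"
      unfolding truncated_mean_def using assms integrable_truncated_step [of b 1]
      by (subst (asm) integral_nonneg_eq_0_iff_AE) (auto simp: step_nonneg)
    then have "AE \<omega> in M. X 1 \<omega> = 0"
      by eventually_elim (use assms in \<open>auto simp: min_def split: if_splits\<close>)
    then have "expectation (X 1) = 0"
      by (intro integral_eq_zero_AE)
    with step_mean_pos show False by simp
  qed
  ultimately show ?thesis by simp
qed

text \<open>
  Truncating the epochs at \<open>c\<close> keeps everything integrable, although the law of the delay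
  \<open>S 0\<close> is arbitrary and may have infinite mean.
\<close>

lemma sum_expectation_telescope:
  assumes "c \<ge> 0"
  shows "(\<Sum>n<N. expectation (\<lambda>\<omega>. min c (S (Suc n) \<omega>) - min c (S n \<omega>))) =
    expectation (\<lambda>\<omega>. min c (S N \<omega>)) - expectation (\<lambda>\<omega>. min c (S 0 \<omega>))"
proof -
  have "expectation (\<lambda>\<omega>. min c (S (Suc n) \<omega>) - min c (S n \<omega>)) =
      expectation (\<lambda>\<omega>. min c (S (Suc n) \<omega>)) - expectation (\<lambda>\<omega>. min c (S n \<omega>))" for n
    by (intro Bochner_Integration.integral_diff integrable_truncated_epoch assms)
  then show ?thesis
    using sum_lessThan_telescope [of "\<lambda>n. expectation (\<lambda>\<omega>. min c (S n \<omega>))" N] by simp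
qed

text \<open>
  Each visit to \<open>{..t}\<close> pushes the walk, truncated at \<open>t + b\<close>, up by at least
  \<open>min (X (Suc n)) b\<close>: from a position at most \<open>t\<close> a step of length at most \<open>b\<close> is not cut off.  The
  total rise being at most \<open>t + b\<close>, the number of visits has finite mean.
\<close>

lemma truncated_mean_partial_sum_le:
  assumes "t \<ge> 0" "b > 0"
  shows "truncated_mean b * (\<Sum>n<N. prob {\<omega> \<in> space M. S n \<omega> \<le> t}) \<le> t + b"
proof -
  have "truncated_mean b * (\<Sum>n<N. prob {\<omega> \<in> space M. S n \<omega> \<le> t}) =
      (\<Sum>n<N. expectation (\<lambda>\<omega>. indicat_real {..t} (S n \<omega>) * min (X (Suc n) \<omega>) b))"
    unfolding truncated_mean_def sum_distrib_left
    by (subst expectation_step_before [where f = "\<lambda>x. min x b"])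
       (use assms in \<open>auto intro!: integrable_truncated_step simp: mult.commute\<close>)
  also have "\<dots> \<le> (\<Sum>n<N. expectation (\<lambda>\<omega>. min (t + b) (S (Suc n) \<omega>) - min (t + b) (S n \<omega>)))"
  proof (intro sum_mono integral_mono)
    fix n \<omega> assume "\<omega> \<in> space M"
    then show "indicat_real {..t} (S n \<omega>) * min (X (Suc n) \<omega>) b
        \<le> min (t + b) (S (Suc n) \<omega>) - min (t + b) (S n \<omega>)"
      using step_nonneg [of \<omega> "Suc n"] assms by (auto simp: epoch_Suc indicator_def)
  next
    fix n
    show "integrable M (\<lambda>\<omega>. indicat_real {..t} (S n \<omega>) * min (X (Suc n) \<omega>) b)"
      using assms
      by (intro integrable_step_before [where f = "\<lambda>x. min x b"] integrable_truncated_step) auto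
  qed (use assms in \<open>auto intro!: integrable_truncated_epoch\<close>)
  also have "\<dots> = expectation (\<lambda>\<omega>. min (t + b) (S N \<omega>)) - expectation (\<lambda>\<omega>. min (t + b) (S 0 \<omega>))"
    using assms by (intro sum_expectation_telescope) auto
  also have "\<dots> \<le> t + b"
  proof -
    have "expectation (\<lambda>\<omega>. min (t + b) (S N \<omega>)) \<le> t + b"
      using assms integral_mono [OF integrable_truncated_epoch [of "t + b" N] integrable_const [of "t + b"]]
      by (auto simp: prob_space)
    moreover have "expectation (\<lambda>\<omega>. min (t + b) (S 0 \<omega>)) \<ge> 0"
      using assms by (intro integral_nonneg_AE) (auto simp: epoch_nonneg)
    ultimately show ?thesis by simp
  qed
  finally show ?thesis .
qed

lemma prob_epoch_le_neg: "t < 0 \<Longrightarrow> prob {\<omega> \<in> space M. S n \<omega> \<le> t} = 0"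
proof -
  assume "t < 0"
  then have "{\<omega> \<in> space M. S n \<omega> \<le> t} = {}"
    using epoch_nonneg [of _ n] by force
  then show ?thesis by (simp only: measure_empty)
qed

lemma summable_prob_epoch_le: "summable (\<lambda>n. prob {\<omega> \<in> space M. S n \<omega> \<le> t})"
proof (cases "t \<ge> 0")
  case True
  show ?thesis
  proof (rule summableI_nonneg_bounded)
    fix N
    show "(\<Sum>n<N. prob {\<omega> \<in> space M. S n \<omega> \<le> t}) \<le> (t + 1) / truncated_mean 1"
      using truncated_mean_partial_sum_le [of t 1 N] truncated_mean_pos [of 1] True
      by (simp add: field_simps)
  qed auto
qed (simp add: prob_epoch_le_neg)

lemma renewal_function_le:
  assumes "t \<ge> 0" "b > 0"
  shows "renewal_function t \<le> (t + b) / truncated_mean b"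
  unfolding renewal_function_def
  using truncated_mean_partial_sum_le [OF assms] truncated_mean_pos [of b] assms
  by (intro suminf_le_const summable_prob_epoch_le) (simp add: field_simps)

lemma mono_renewal_function: "mono renewal_function"
  unfolding renewal_function_def
  by (intro monoI suminf_le summable_prob_epoch_le finite_measure_mono) auto

lemma renewal_function_nonneg: "renewal_function t \<ge> 0"
  unfolding renewal_function_def by (intro suminf_nonneg summable_prob_epoch_le) auto

lemma renewal_function_measurable [measurable]: "renewal_function \<in> borel_measurable borel"
  by (rule borel_measurable_mono [OF mono_renewal_function])

text \<open>
  Only steps that start in \<open>{..t}\<close> raise \<open>min t (S n)\<close>, and by at most their length, while
  \<open>min t (S N)\<close> reaches \<open>t\<close> in mean as \<open>N \<rightarrow> \<infinity>\<close>, because the summability of the probabilities of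
  \<open>S N \<le> t\<close> makes them tend to \<open>0\<close>.
\<close>

lemma renewal_function_ge:
  assumes "t \<ge> 0"
  shows "t - expectation (\<lambda>\<omega>. min t (S 0 \<omega>)) \<le> expectation (X 1) * renewal_function t"
proof -
  have upper: "expectation (\<lambda>\<omega>. min t (S N \<omega>)) - expectation (\<lambda>\<omega>. min t (S 0 \<omega>))
      \<le> expectation (X 1) * renewal_function t" for N
  proof -
    have "expectation (\<lambda>\<omega>. min t (S N \<omega>)) - expectation (\<lambda>\<omega>. min t (S 0 \<omega>)) =
        (\<Sum>n<N. expectation (\<lambda>\<omega>. min t (S (Suc n) \<omega>) - min t (S n \<omega>)))"
      by (rule sum_expectation_telescope [OF assms, symmetric])
    also have "\<dots> \<le> (\<Sum>n<N. expectation (\<lambda>\<omega>. indicat_real {..t} (S n \<omega>) * X (Suc n) \<omega>))"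
    proof (intro sum_mono integral_mono)
      fix n \<omega> assume "\<omega> \<in> space M"
      then show "min t (S (Suc n) \<omega>) - min t (S n \<omega>) \<le> indicat_real {..t} (S n \<omega>) * X (Suc n) \<omega>"
        using step_nonneg [of \<omega> "Suc n"] by (auto simp: epoch_Suc indicator_def)
    next
      fix n
      show "integrable M (\<lambda>\<omega>. indicat_real {..t} (S n \<omega>) * X (Suc n) \<omega>)"
        by (rule integrable_step_before [where f = "\<lambda>x. x"]) (use step_integrable in auto)
    qed (use assms in \<open>auto intro!: integrable_truncated_epoch\<close>)
    also have "\<dots> = expectation (X 1) * (\<Sum>n<N. prob {\<omega> \<in> space M. S n \<omega> \<le> t})"
      unfolding sum_distrib_left
      by (subst expectation_step_before [where f = "\<lambda>x. x"]) (use step_integrable in \<open>auto simp: mult.commute\<close>)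
    also have "\<dots> \<le> expectation (X 1) * renewal_function t"
      unfolding renewal_function_def using step_mean_pos
      by (intro mult_left_mono sum_le_suminf summable_prob_epoch_le) auto
    finally show ?thesis .
  qed
  have lower: "t * (1 - prob {\<omega> \<in> space M. S N \<omega> \<le> t}) \<le> expectation (\<lambda>\<omega>. min t (S N \<omega>))" for N
  proof -
    have int: "integrable M (\<lambda>\<omega>. t * (1 - indicator {\<omega> \<in> space M. S N \<omega> \<le> t} \<omega>) :: real)"
      by (auto intro!: Bochner_Integration.integrable_mult_right Bochner_Integration.integrable_diff
          integrable_real_indicator simp: emeasure_eq_measure)
    have "t * (1 - prob {\<omega> \<in> space M. S N \<omega> \<le> t}) =
        expectation (\<lambda>\<omega>. t * (1 - indicator {\<omega> \<in> space M. S N \<omega> \<le> t} \<omega>))"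
      by (auto simp: prob_space emeasure_eq_measure intro!: arg_cong [where f = prob])
    also have "\<dots> \<le> expectation (\<lambda>\<omega>. min t (S N \<omega>))"
      by (rule integral_mono [OF int integrable_truncated_epoch [OF assms]])
         (use assms in \<open>auto simp: indicator_def epoch_nonneg\<close>)
    finally show ?thesis .
  qed
  have "(\<lambda>N. prob {\<omega> \<in> space M. S N \<omega> \<le> t}) \<longlonglongrightarrow> 0"
    by (rule summable_LIMSEQ_zero [OF summable_prob_epoch_le])
  then have "(\<lambda>N. t * (1 - prob {\<omega> \<in> space M. S N \<omega> \<le> t}) - expectation (\<lambda>\<omega>. min t (S 0 \<omega>)))
      \<longlonglongrightarrow> t * (1 - 0) - expectation (\<lambda>\<omega>. min t (S 0 \<omega>))"
    by (intro tendsto_intros)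
  moreover have "\<forall>N. t * (1 - prob {\<omega> \<in> space M. S N \<omega> \<le> t}) - expectation (\<lambda>\<omega>. min t (S 0 \<omega>))
      \<le> expectation (X 1) * renewal_function t"
    using upper lower by (smt (verit))
  ultimately show ?thesis
    using LIMSEQ_le_const2 by fastforce
qed

lemma truncated_delay_negligible:
  "((\<lambda>t. expectation (\<lambda>\<omega>. min t (S 0 \<omega>)) / t) \<longlongrightarrow> 0) at_top"
proof -
  have "((\<lambda>t. expectation (\<lambda>\<omega>. min t (S 0 \<omega>) / t)) \<longlongrightarrow> expectation (\<lambda>\<omega>. 0)) at_top"
  proof (rule integral_dominated_convergence_at_top [where w = "\<lambda>_. 1"])
    show "AE \<omega> in M. ((\<lambda>t. min t (S 0 \<omega>) / t) \<longlongrightarrow> 0) at_top"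
    proof (rule AE_I2)
      fix \<omega>
      have "((\<lambda>t. S 0 \<omega> / t) \<longlongrightarrow> 0) at_top"
        by (intro tendsto_divide_0 [OF tendsto_const] filterlim_at_top_imp_at_infinity filterlim_ident)
      moreover have "\<forall>\<^sub>F t in at_top. S 0 \<omega> / t = min t (S 0 \<omega>) / t"
        using eventually_ge_at_top [of "S 0 \<omega>"] by eventually_elim simp
      ultimately show "((\<lambda>t. min t (S 0 \<omega>) / t) \<longlongrightarrow> 0) at_top"
        by (rule Lim_transform_eventually)
    qed
    show "\<forall>\<^sub>F t in at_top. AE \<omega> in M. norm (min t (S 0 \<omega>) / t) \<le> 1"
      using eventually_gt_at_top [of 0] by eventually_elim (auto simp: epoch_nonneg)
  qed auto
  then show ?thesis by simp
qed

text \<open>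
  The lower bound is sharp at once; the upper bound has the constant \<open>1 / truncated_mean b\<close>, which
  is brought below any \<open>c > 1 / \<mu>\<close> by fixing \<open>b\<close> large before letting \<open>t\<close> grow.
\<close>

theorem elementary_renewal_theorem:
  "((\<lambda>t. renewal_function t / t) \<longlongrightarrow> 1 / expectation (X 1)) at_top"
proof (rule order_tendstoI)
  fix a assume a: "a < 1 / expectation (X 1)"
  have "((\<lambda>t. (1 - expectation (\<lambda>\<omega>. min t (S 0 \<omega>)) / t) / expectation (X 1))
      \<longlongrightarrow> (1 - 0) / expectation (X 1)) at_top"
    using step_mean_pos by (intro tendsto_intros truncated_delay_negligible) auto
  then have "\<forall>\<^sub>F t in at_top. a < (1 - expectation (\<lambda>\<omega>. min t (S 0 \<omega>)) / t) / expectation (X 1)"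
    by (rule order_tendstoD) (use a in simp)
  with eventually_gt_at_top [of 0] show "\<forall>\<^sub>F t in at_top. a < renewal_function t / t"
  proof eventually_elim
    case (elim t)
    then have "(1 - expectation (\<lambda>\<omega>. min t (S 0 \<omega>)) / t) / expectation (X 1) \<le> renewal_function t / t"
    proof -
      have "(t - expectation (\<lambda>\<omega>. min t (S 0 \<omega>))) / expectation (X 1) / t \<le> renewal_function t / t"
        using renewal_function_ge [of t] step_mean_pos elim
        by (intro divide_right_mono) (auto simp: pos_divide_le_eq mult.commute)
      then show ?thesis
        using elim by (simp add: diff_divide_distrib mult.commute)
    qed
    with elim show ?case by simp
  qed
next
  fix c assume c: "1 / expectation (X 1) < c"
  have "((\<lambda>b. 1 / truncated_mean b) \<longlongrightarrow> 1 / expectation (X 1)) at_top"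
    using step_mean_pos by (intro tendsto_intros truncated_mean_tendsto) auto
  then have "\<forall>\<^sub>F b in at_top. 1 / truncated_mean b < c"
    by (rule order_tendstoD) (use c in simp)
  with eventually_gt_at_top [of "0::real"] have "\<forall>\<^sub>F b in at_top. b > 0 \<and> 1 / truncated_mean b < c"
    by eventually_elim auto
  from eventually_happens [OF this] obtain b where b: "b > 0" "1 / truncated_mean b < c"
    by auto
  have "((\<lambda>t. (1 + b / t) / truncated_mean b) \<longlongrightarrow> (1 + 0) / truncated_mean b) at_top"
    using truncated_mean_pos [OF b(1)]
    by (intro tendsto_intros tendsto_divide_0 [OF tendsto_const]
        filterlim_at_top_imp_at_infinity filterlim_ident) auto
  then have "\<forall>\<^sub>F t in at_top. (1 + b / t) / truncated_mean b < c"
    by (rule order_tendstoD) (use b in simp)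
  with eventually_gt_at_top [of 0] show "\<forall>\<^sub>F t in at_top. renewal_function t / t < c"
  proof eventually_elim
    case (elim t)
    then have "renewal_function t / t \<le> (1 + b / t) / truncated_mean b"
      using renewal_function_le [of t b] b truncated_mean_pos [OF b(1)] by (simp add: field_simps)
    with elim show ?case by simp
  qed
qed

lemma renewal_window_tendsto:
  "((\<lambda>t. (renewal_function (t - a) - renewal_function (- a)) / t) \<longlongrightarrow> 1 / expectation (X 1)) at_top"
proof -
  have shift: "filterlim (\<lambda>t::real. t - a) at_top at_top"
    using filterlim_tendsto_add_at_top [OF tendsto_const [of "-a"] filterlim_ident]
    by simp
  have inv: "((\<lambda>t::real. c / t) \<longlongrightarrow> 0) at_top" for c
    by (intro tendsto_divide_0 [OF tendsto_const] filterlim_at_top_imp_at_infinity filterlim_ident)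
  have "((\<lambda>t. renewal_function (t - a) / (t - a) * (1 - a / t) - renewal_function (- a) / t)
      \<longlongrightarrow> 1 / expectation (X 1) * (1 - 0) - 0) at_top"
    by (intro tendsto_intros inv filterlim_compose [OF elementary_renewal_theorem shift])
  then have "((\<lambda>t. renewal_function (t - a) / (t - a) * (1 - a / t) - renewal_function (- a) / t)
      \<longlongrightarrow> 1 / expectation (X 1)) at_top" by simp
  moreover have "\<forall>\<^sub>F t in at_top. renewal_function (t - a) / (t - a) * (1 - a / t) - renewal_function (- a) / t
      = (renewal_function (t - a) - renewal_function (- a)) / t"
    using eventually_gt_at_top [of "max 0 a"] by eventually_elim (simp add: field_simps)
  ultimately show ?thesis by (rule Lim_transform_eventually)
qed

lemma renewal_window_nonneg: "t \<ge> 0 \<Longrightarrow> renewal_function (t - a) - renewal_function (- a) \<ge> 0"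
  using monoD [OF mono_renewal_function, of "- a" "t - a"] by simp

text \<open>
  The bound is uniform in \<open>t \<ge> 1\<close> and linear in the displacement \<open>a\<close> of the window; it is used to
  dominate the contributions of the points of a cluster.
\<close>

lemma renewal_window_le:
  assumes "t \<ge> 1"
  shows "(renewal_function (t - a) - renewal_function (- a)) / t \<le> (2 + \<bar>a\<bar>) / truncated_mean 1"
proof -
  have "renewal_function (t - a) \<le> renewal_function (t + \<bar>a\<bar>)"
    by (rule monoD [OF mono_renewal_function]) linarith
  then have "renewal_function (t - a) - renewal_function (- a) \<le> renewal_function (t + \<bar>a\<bar>)"
    using renewal_function_nonneg [of "- a"] by simp
  also have "\<dots> \<le> (t + \<bar>a\<bar> + 1) / truncated_mean 1"
    using assms by (intro renewal_function_le) auto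
  also have "\<dots> \<le> t * ((2 + \<bar>a\<bar>) / truncated_mean 1)"
  proof -
    have "\<bar>a\<bar> \<le> t * \<bar>a\<bar>"
      using assms mult_right_mono [of 1 t "\<bar>a\<bar>"] by simp
    then show ?thesis
      using assms truncated_mean_pos [of 1] by (simp add: divide_right_mono algebra_simps)
  qed
  finally show ?thesis
    using assms by (simp add: field_simps)
qed

lemma suminf_epoch_window:
  assumes "t \<ge> 0"
  shows "(\<Sum>n. \<integral>\<^sup>+ \<omega>. indicator {0<..t} (S n \<omega> + a) \<partial>M) =
    ennreal (renewal_function (t - a) - renewal_function (- a))"
proof -
  let ?p = "\<lambda>n s. prob {\<omega> \<in> space M. S n \<omega> \<le> s}"
  have "(\<integral>\<^sup>+ \<omega>. indicator {0<..t} (S n \<omega> + a) \<partial>M) = ennreal (?p n (t - a) - ?p n (- a))" for n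
  proof -
    have "(\<integral>\<^sup>+ \<omega>. indicator {0<..t} (S n \<omega> + a) \<partial>M) =
        (\<integral>\<^sup>+ \<omega>. indicator ({\<omega> \<in> space M. S n \<omega> \<le> t - a} - {\<omega> \<in> space M. S n \<omega> \<le> - a}) \<omega> \<partial>M)"
      by (rule nn_integral_cong) (auto simp: indicator_def)
    also have "\<dots> = ennreal (prob ({\<omega> \<in> space M. S n \<omega> \<le> t - a} - {\<omega> \<in> space M. S n \<omega> \<le> - a}))"
      by (simp add: emeasure_eq_measure)
    also have "\<dots> = ennreal (?p n (t - a) - ?p n (- a))"
      using assms by (subst finite_measure_Diff) auto
    finally show ?thesis .
  qed
  moreover have "?p n (- a) \<le> ?p n (t - a)" for n
    using assms by (intro finite_measure_mono) auto
  moreover have "(\<Sum>n. ?p n (t - a) - ?p n (- a)) = renewal_function (t - a) - renewal_function (- a)"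
    unfolding renewal_function_def by (rule suminf_diff [symmetric]) (rule summable_prob_epoch_le)+
  ultimately show ?thesis
    by (simp add: suminf_ennreal2 summable_diff summable_prob_epoch_le)
qed

end

section \<open>Reduction of the cluster process to the renewal function\<close>

context renewal_cluster_process
begin

text \<open>
  The base point \<open>s\<close> is the epoch preceding the cluster: the increment leading to the cluster is part
  of its mark, may depend on its points, and is therefore added here.
\<close>

definition shifted_count :: "real set \<Rightarrow> real \<Rightarrow> nat \<times> (nat \<Rightarrow> real) \<times> real \<Rightarrow> ennreal" where
  "shifted_count B s m = (\<Sum>j=1..fst m. indicator B (s + (snd (snd m) + fst (snd m) j)))"

lemma shifted_count_measurable [measurable]:
  assumes [measurable]: "B \<in> sets borel"
  shows "case_prod (shifted_count B) \<in> borel_measurable (borel \<Otimes>\<^sub>M mark_space)"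
proof -
  have "(\<lambda>p. \<Sum>j=1..l. indicator B (fst p + (snd (snd (snd p)) + fst (snd (snd p)) j)) :: ennreal)
      \<in> borel_measurable (borel \<Otimes>\<^sub>M mark_space)" for l
  proof (rule borel_measurable_sum)
    fix j assume "j \<in> {1..l}"
    then have [measurable]: "(\<lambda>\<tau>. \<tau> j) \<in> borel_measurable (PiM {1..} (\<lambda>_. borel))"
      by (intro measurable_component_singleton) auto
    show "(\<lambda>p. indicator B (fst p + (snd (snd (snd p)) + fst (snd (snd p)) j)) :: ennreal)
        \<in> borel_measurable (borel \<Otimes>\<^sub>M mark_space)"
      unfolding mark_space_def by measurable
  qed
  moreover have "(\<lambda>p. fst (snd p)) \<in> (borel :: real measure) \<Otimes>\<^sub>M mark_space \<rightarrow>\<^sub>M count_space UNIV"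
    unfolding mark_space_def by measurable
  ultimately show ?thesis
    unfolding shifted_count_def case_prod_beta
    by (rule measurable_compose_countable)
qed

lemma mark_measurable [measurable]: "cluster_mark L T X i \<in> M \<rightarrow>\<^sub>M mark_space"
  using indep_marks by (auto simp: indep_vars_def)

lemma L_measurable [measurable]: "L i \<in> M \<rightarrow>\<^sub>M count_space UNIV"
proof -
  have "fst \<in> mark_space \<rightarrow>\<^sub>M count_space UNIV"
    unfolding mark_space_def by measurable
  from measurable_compose [OF mark_measurable [of i] this] show ?thesis
    by (simp add: cluster_mark_def)
qed

lemma T_measurable:
  assumes "j \<ge> 1"
  shows "T i j \<in> borel_measurable M"
proof -
  have [measurable]: "(\<lambda>\<tau>. \<tau> j) \<in> borel_measurable (PiM {1..} (\<lambda>_. borel))"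
    using assms by (intro measurable_component_singleton) auto
  have "(\<lambda>m. fst (snd m) j) \<in> mark_space \<rightarrow>\<^sub>M borel"
    unfolding mark_space_def by measurable
  from measurable_compose [OF mark_measurable [of i] this] show ?thesis
    using assms by (simp add: cluster_mark_def)
qed

lemma increment_of_mark_measurable: "(\<lambda>m. snd (snd m)) \<in> mark_space \<rightarrow>\<^sub>M borel"
  unfolding mark_space_def by measurable

lemma distr_increment:
  "distr M borel (X i) = distr (distr M mark_space (cluster_mark L T X i)) borel (\<lambda>m. snd (snd m))"
  by (subst distr_distr [OF increment_of_mark_measurable mark_measurable])
     (simp add: comp_def cluster_mark_def)

sublocale delayed_renewal_sequence M X
proof
  show "indep_vars (\<lambda>_. borel) X UNIV"
    using indep_vars_compose2 [OF indep_marks, of "\<lambda>_ m. snd (snd m)" "\<lambda>_. borel"]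
      increment_of_mark_measurable
    by (simp add: cluster_mark_def)
  show "distr M borel (X i) = distr M borel (X 1)" if "i \<ge> 1" for i
    using ident_marks [OF that] distr_increment by simp
qed (use X_nonneg X_integrable X_mean_pos in auto)

text \<open>
  The epoch \<open>S n\<close> is a function of the marks of index at most \<open>n\<close>.  The product law of the two blocks
  of marks is pushed forward, since \<open>indep_var\<close> relates only variables with values in the same type.
\<close>

lemma distr_epoch_mark:
  "distr M (borel \<Otimes>\<^sub>M mark_space) (\<lambda>\<omega>. (S n \<omega>, cluster_mark L T X (Suc n) \<omega>)) =
    distr M borel (S n) \<Otimes>\<^sub>M distr M mark_space (cluster_mark L T X (Suc n))"
proof -
  let ?PA = "PiM {0..n} (\<lambda>_. mark_space)" and ?PB = "PiM {Suc n} (\<lambda>_. mark_space)"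
  let ?A = "\<lambda>\<omega>. restrict (\<lambda>i. cluster_mark L T X i \<omega>) {0..n}"
  let ?B = "\<lambda>\<omega>. restrict (\<lambda>i. cluster_mark L T X i \<omega>) {Suc n}"
  let ?f = "\<lambda>x :: nat \<Rightarrow> nat \<times> (nat \<Rightarrow> real) \<times> real. \<Sum>j=0..n. snd (snd (x j))"
  let ?g = "\<lambda>x :: nat \<Rightarrow> nat \<times> (nat \<Rightarrow> real) \<times> real. x (Suc n)"
  have f [measurable]: "?f \<in> borel_measurable ?PA"
    by (intro borel_measurable_sum measurable_compose [OF _ increment_of_mark_measurable]
        measurable_component_singleton) auto
  have g [measurable]: "?g \<in> ?PB \<rightarrow>\<^sub>M mark_space"
    by (intro measurable_component_singleton) auto
  have fA: "?f (?A \<omega>) = S n \<omega>" and gB: "?g (?B \<omega>) = cluster_mark L T X (Suc n) \<omega>" for \<omega>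
    by (auto simp: renewal_epoch_def cluster_mark_def intro!: sum.cong)
  have "indep_var ?PA ?A ?PB ?B"
    by (rule indep_var_restrict [OF indep_marks]) auto
  then have A: "?A \<in> M \<rightarrow>\<^sub>M ?PA" and B: "?B \<in> M \<rightarrow>\<^sub>M ?PB"
    and AB: "distr M ?PA ?A \<Otimes>\<^sub>M distr M ?PB ?B = distr M (?PA \<Otimes>\<^sub>M ?PB) (\<lambda>\<omega>. (?A \<omega>, ?B \<omega>))"
    by (simp_all only: indep_var_distribution_eq)
  have S: "distr M borel (S n) = distr (distr M ?PA ?A) borel ?f"
    by (subst distr_distr [OF f A]) (simp only: comp_def fA)
  have Q: "distr M mark_space (cluster_mark L T X (Suc n)) = distr (distr M ?PB ?B) mark_space ?g"
    by (subst distr_distr [OF g B]) (simp only: comp_def gB)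
  have sf: "sigma_finite_measure (distr (distr M ?PB ?B) mark_space ?g)"
    unfolding Q [symmetric]
    by (intro prob_space_imp_sigma_finite prob_space_distr mark_measurable)
  have "distr M borel (S n) \<Otimes>\<^sub>M distr M mark_space (cluster_mark L T X (Suc n)) =
      distr (distr M ?PA ?A \<Otimes>\<^sub>M distr M ?PB ?B) (borel \<Otimes>\<^sub>M mark_space) (\<lambda>(x, y). (?f x, ?g y))"
    unfolding S Q by (rule pair_measure_distr [OF _ _ sf]) (use f g in simp_all)
  also have "\<dots> = distr M (borel \<Otimes>\<^sub>M mark_space) ((\<lambda>(x, y). (?f x, ?g y)) \<circ> (\<lambda>\<omega>. (?A \<omega>, ?B \<omega>)))"
    unfolding AB using A B by (intro distr_distr) measurable
  also have "(\<lambda>(x, y). (?f x, ?g y)) \<circ> (\<lambda>\<omega>. (?A \<omega>, ?B \<omega>)) =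
      (\<lambda>\<omega>. (S n \<omega>, cluster_mark L T X (Suc n) \<omega>))"
    by (simp only: comp_def prod.case fA gB)
  finally show ?thesis by simp
qed

text \<open>
  In law, the mark at index \<open>Suc n\<close> may be replaced by an independent copy of the mark at index \<open>1\<close>.
  Putting the mark in the outer integral makes the inner one a probability for \<open>S n\<close> alone, ready to
  be summed over \<open>n\<close>.
\<close>

lemma nn_integral_later_cluster:
  assumes [measurable]: "B \<in> sets borel"
  shows "(\<integral>\<^sup>+ \<omega>. shifted_count B (S n \<omega>) (cluster_mark L T X (Suc n) \<omega>) \<partial>M) =
    (\<integral>\<^sup>+ \<omega>. (\<integral>\<^sup>+ \<omega>'. shifted_count B (S n \<omega>') (cluster_mark L T X 1 \<omega>) \<partial>M) \<partial>M)"
proof -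
  let ?P = "distr M borel (S n)" and ?Q = "\<lambda>i. distr M mark_space (cluster_mark L T X i)"
  interpret P: prob_space ?P by (rule prob_space_distr) measurable
  interpret Q: prob_space "?Q 1" by (rule prob_space_distr) measurable
  interpret PQ: pair_prob_space ?P "?Q 1" ..
  have "(\<integral>\<^sup>+ \<omega>. shifted_count B (S n \<omega>) (cluster_mark L T X (Suc n) \<omega>) \<partial>M) =
      (\<integral>\<^sup>+ p. case_prod (shifted_count B) p
        \<partial>distr M (borel \<Otimes>\<^sub>M mark_space) (\<lambda>\<omega>. (S n \<omega>, cluster_mark L T X (Suc n) \<omega>)))"
    by (subst nn_integral_distr) auto
  also have "\<dots> = (\<integral>\<^sup>+ p. case_prod (shifted_count B) p \<partial>(?P \<Otimes>\<^sub>M ?Q (Suc n)))"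
    by (simp only: distr_epoch_mark)
  also have "?Q (Suc n) = ?Q 1"
    by (rule ident_marks) simp
  also have "(\<integral>\<^sup>+ p. case_prod (shifted_count B) p \<partial>(?P \<Otimes>\<^sub>M ?Q 1)) =
      (\<integral>\<^sup>+ m. (\<integral>\<^sup>+ s. shifted_count B s m \<partial>?P) \<partial>?Q 1)"
    by (subst PQ.nn_integral_snd [symmetric]) auto
  also have "\<dots> = (\<integral>\<^sup>+ \<omega>. (\<integral>\<^sup>+ s. shifted_count B s (cluster_mark L T X 1 \<omega>) \<partial>?P) \<partial>M)"
  proof (rule nn_integral_distr)
    have "case_prod (\<lambda>m s. shifted_count B s m) \<in> borel_measurable (mark_space \<Otimes>\<^sub>M ?P)"
      by measurable
    then have "(\<lambda>m. \<integral>\<^sup>+ s. shifted_count B s m \<partial>?P) \<in> borel_measurable mark_space"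
      by (rule P.borel_measurable_nn_integral)
    then show "(\<lambda>m. \<integral>\<^sup>+ s. shifted_count B s m \<partial>?P) \<in> borel_measurable (?Q 1)"
      by simp
  qed measurable
  also have "\<dots> = (\<integral>\<^sup>+ \<omega>. (\<integral>\<^sup>+ \<omega>'. shifted_count B (S n \<omega>') (cluster_mark L T X 1 \<omega>) \<partial>M) \<partial>M)"
  proof (rule nn_integral_cong)
    fix \<omega> assume "\<omega> \<in> space M"
    then have "cluster_mark L T X 1 \<omega> \<in> space mark_space"
      using measurable_space [OF mark_measurable] by blast
    then have "(\<lambda>s. shifted_count B s (cluster_mark L T X 1 \<omega>)) \<in> borel_measurable borel"
      using measurable_compose [OF measurable_Pair2' shifted_count_measurable [OF assms]] by simp
    then show "(\<integral>\<^sup>+ s. shifted_count B s (cluster_mark L T X 1 \<omega>) \<partial>?P) =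
        (\<integral>\<^sup>+ \<omega>'. shifted_count B (S n \<omega>') (cluster_mark L T X 1 \<omega>) \<partial>M)"
      by (intro nn_integral_distr) auto
  qed
  finally show ?thesis .
qed

text \<open>
  The expected number of points of clusters of index at least \<open>1\<close> in \<open>{0<..t}\<close>, if they all had the
  mark of index \<open>1\<close> at \<open>\<omega>\<close>, including its increment, each following an epoch drawn independently of
  that mark.
\<close>

definition window_sum :: "real \<Rightarrow> 'a \<Rightarrow> real" where
  "window_sum t \<omega> = (\<Sum>j=1..L 1 \<omega>.
     renewal_function (t - (X 1 \<omega> + T 1 j \<omega>)) - renewal_function (- (X 1 \<omega> + T 1 j \<omega>)))"

lemma window_sum_measurable [measurable]: "window_sum t \<in> borel_measurable M"
proof -
  have "(\<lambda>\<omega>. \<Sum>j=1..l.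
      renewal_function (t - (X 1 \<omega> + T 1 j \<omega>)) - renewal_function (- (X 1 \<omega> + T 1 j \<omega>)))
      \<in> borel_measurable M" for l
  proof (rule borel_measurable_sum)
    fix j assume "j \<in> {1..l}"
    then have [measurable]: "T 1 j \<in> borel_measurable M"
      by (intro T_measurable) auto
    show "(\<lambda>\<omega>. renewal_function (t - (X 1 \<omega> + T 1 j \<omega>)) - renewal_function (- (X 1 \<omega> + T 1 j \<omega>)))
        \<in> borel_measurable M"
      by measurable
  qed
  then show ?thesis
    unfolding window_sum_def [abs_def] by (rule measurable_compose_countable) measurable
qed

lemma window_sum_nonneg: "t \<ge> 0 \<Longrightarrow> window_sum t \<omega> \<ge> 0"
  unfolding window_sum_def by (intro sum_nonneg renewal_window_nonneg)

lemma nn_integral_later_clusters: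
  assumes "t \<ge> 0"
  shows "(\<Sum>n. \<integral>\<^sup>+ \<omega>. shifted_count {0<..t} (S n \<omega>) (cluster_mark L T X (Suc n) \<omega>) \<partial>M) =
    (\<integral>\<^sup>+ \<omega>. ennreal (window_sum t \<omega>) \<partial>M)"
proof -
  let ?a = "\<lambda>j \<omega>. X 1 \<omega> + T 1 j \<omega>"
  have single: "(\<integral>\<^sup>+ \<omega>'. shifted_count {0<..t} (S n \<omega>') (cluster_mark L T X 1 \<omega>) \<partial>M) =
      (\<Sum>j=1..L 1 \<omega>. \<integral>\<^sup>+ \<omega>'. indicator {0<..t} (S n \<omega>' + ?a j \<omega>) \<partial>M)" for n \<omega>
    by (simp add: shifted_count_def cluster_mark_def nn_integral_sum)
  have meas: "(\<lambda>\<omega>. \<integral>\<^sup>+ \<omega>'. shifted_count {0<..t} (S n \<omega>') (cluster_mark L T X 1 \<omega>) \<partial>M)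
      \<in> borel_measurable M" for n
    by measurable
  have "(\<Sum>n. \<integral>\<^sup>+ \<omega>. shifted_count {0<..t} (S n \<omega>) (cluster_mark L T X (Suc n) \<omega>) \<partial>M) =
      (\<Sum>n. \<integral>\<^sup>+ \<omega>. (\<integral>\<^sup>+ \<omega>'. shifted_count {0<..t} (S n \<omega>') (cluster_mark L T X 1 \<omega>) \<partial>M) \<partial>M)"
    by (simp add: nn_integral_later_cluster)
  also have "\<dots> =
      (\<integral>\<^sup>+ \<omega>. (\<Sum>n. \<integral>\<^sup>+ \<omega>'. shifted_count {0<..t} (S n \<omega>') (cluster_mark L T X 1 \<omega>) \<partial>M) \<partial>M)"
    by (rule nn_integral_suminf [symmetric]) (rule meas)
  also have "\<dots> = (\<integral>\<^sup>+ \<omega>. ennreal (window_sum t \<omega>) \<partial>M)"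
  proof (rule nn_integral_cong)
    fix \<omega>
    have "(\<Sum>n. \<integral>\<^sup>+ \<omega>'. shifted_count {0<..t} (S n \<omega>') (cluster_mark L T X 1 \<omega>) \<partial>M) =
        (\<Sum>j=1..L 1 \<omega>. \<Sum>n. \<integral>\<^sup>+ \<omega>'. indicator {0<..t} (S n \<omega>' + ?a j \<omega>) \<partial>M)"
      unfolding single by (rule suminf_sum) auto
    also have "\<dots> = (\<Sum>j=1..L 1 \<omega>.
        ennreal (renewal_function (t - ?a j \<omega>) - renewal_function (- ?a j \<omega>)))"
      using assms by (simp only: suminf_epoch_window)
    also have "\<dots> = ennreal (window_sum t \<omega>)"
      unfolding window_sum_def using assms by (intro sum_ennreal renewal_window_nonneg)
    finally show "(\<Sum>n. \<integral>\<^sup>+ \<omega>'. shifted_count {0<..t} (S n \<omega>') (cluster_mark L T X 1 \<omega>) \<partial>M) =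
        ennreal (window_sum t \<omega>)" .
  qed
  finally show ?thesis .
qed

lemma cluster_term_eq_shifted_count:
  "(\<Sum>j=1..L (Suc n) \<omega>. indicator B (S (Suc n) \<omega> + T (Suc n) j \<omega>)) =
    shifted_count B (S n \<omega>) (cluster_mark L T X (Suc n) \<omega>)"
  by (simp add: shifted_count_def cluster_mark_def epoch_Suc add_ac)

lemma nn_integral_cluster_process:
  assumes "t \<ge> 0"
  shows "(\<integral>\<^sup>+ \<omega>. cluster_process L T X \<omega> {0<..t} \<partial>M) =
    (\<integral>\<^sup>+ \<omega>. (\<Sum>j=1..L 0 \<omega>. indicator {0<..t} (S 0 \<omega> + T 0 j \<omega>)) \<partial>M) +
    (\<integral>\<^sup>+ \<omega>. ennreal (window_sum t \<omega>) \<partial>M)"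
proof -
  let ?f = "\<lambda>i \<omega>. \<Sum>j=1..L i \<omega>. indicator {0<..t} (S i \<omega> + T i j \<omega>) :: ennreal"
  have [measurable]: "?f i \<in> borel_measurable M" for i
  proof (rule measurable_compose_countable [OF _ L_measurable], rule borel_measurable_sum)
    fix j l :: nat assume "j \<in> {1..l}"
    then have [measurable]: "T i j \<in> borel_measurable M"
      by (intro T_measurable) auto
    show "(\<lambda>\<omega>. indicator {0<..t} (S i \<omega> + T i j \<omega>) :: ennreal) \<in> borel_measurable M"
      by measurable
  qed
  have "(\<integral>\<^sup>+ \<omega>. cluster_process L T X \<omega> {0<..t} \<partial>M) = (\<Sum>i. \<integral>\<^sup>+ \<omega>. ?f i \<omega> \<partial>M)"
    unfolding cluster_process_def by (rule nn_integral_suminf) measurable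
  also have "\<dots> = (\<Sum>i. \<integral>\<^sup>+ \<omega>. ?f (Suc i) \<omega> \<partial>M) + (\<integral>\<^sup>+ \<omega>. ?f 0 \<omega> \<partial>M)"
    using suminf_offset [of "\<lambda>i. \<integral>\<^sup>+ \<omega>. ?f i \<omega> \<partial>M" 1] by (simp add: add.commute)
  also have "(\<Sum>i. \<integral>\<^sup>+ \<omega>. ?f (Suc i) \<omega> \<partial>M) = (\<integral>\<^sup>+ \<omega>. ennreal (window_sum t \<omega>) \<partial>M)"
    unfolding cluster_term_eq_shifted_count by (rule nn_integral_later_clusters [OF assms])
  finally show ?thesis by (simp add: add.commute)
qed

section \<open>Dominated convergence over the mark of a cluster\<close>

lemma abs_point_le_cluster_radius:
  assumes "j \<in> {1..L i \<omega>}"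
  shows "\<bar>T i j \<omega>\<bar> \<le> cluster_radius L T i \<omega>"
  using assms unfolding cluster_radius_def by (auto intro!: cSUP_upper)

lemma window_sum_le:
  assumes "t \<ge> 1" "\<omega> \<in> space M"
  shows "window_sum t \<omega> / t \<le>
    real (L 1 \<omega>) * ((2 + X 1 \<omega> + cluster_radius L T 1 \<omega>) / truncated_mean 1)"
proof -
  have "window_sum t \<omega> / t = (\<Sum>j=1..L 1 \<omega>.
      (renewal_function (t - (X 1 \<omega> + T 1 j \<omega>)) - renewal_function (- (X 1 \<omega> + T 1 j \<omega>))) / t)"
    by (simp add: window_sum_def sum_divide_distrib)
  also have "\<dots> \<le> (\<Sum>j=1..L 1 \<omega>. (2 + X 1 \<omega> + cluster_radius L T 1 \<omega>) / truncated_mean 1)"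
  proof (rule sum_mono)
    fix j assume "j \<in> {1..L 1 \<omega>}"
    then have "\<bar>X 1 \<omega> + T 1 j \<omega>\<bar> \<le> X 1 \<omega> + cluster_radius L T 1 \<omega>"
      using abs_point_le_cluster_radius [of j 1 \<omega>] X_nonneg [OF assms(2), of 1] by simp
    then have "(2 + \<bar>X 1 \<omega> + T 1 j \<omega>\<bar>) / truncated_mean 1
        \<le> (2 + X 1 \<omega> + cluster_radius L T 1 \<omega>) / truncated_mean 1"
      using truncated_mean_pos [of 1] by (intro divide_right_mono) auto
    with renewal_window_le [OF assms(1), of "X 1 \<omega> + T 1 j \<omega>"]
    show "(renewal_function (t - (X 1 \<omega> + T 1 j \<omega>)) - renewal_function (- (X 1 \<omega> + T 1 j \<omega>))) / t
        \<le> (2 + X 1 \<omega> + cluster_radius L T 1 \<omega>) / truncated_mean 1"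
      by (rule order_trans)
  qed
  finally show ?thesis by simp
qed

context
  assumes L_integrable: "integrable M (\<lambda>\<omega>. real (L 1 \<omega>))"
    and LX_integrable: "integrable M (\<lambda>\<omega>. real (L 1 \<omega>) * X 1 \<omega>)"
    and LR_integrable: "integrable M (\<lambda>\<omega>. real (L 1 \<omega>) * cluster_radius L T 1 \<omega>)"
begin

lemma integrable_window_bound:
  "integrable M (\<lambda>\<omega>. real (L 1 \<omega>) * ((2 + X 1 \<omega> + cluster_radius L T 1 \<omega>) / truncated_mean 1))"
proof -
  have "integrable M (\<lambda>\<omega>. (2 * real (L 1 \<omega>) + real (L 1 \<omega>) * X 1 \<omega>
      + real (L 1 \<omega>) * cluster_radius L T 1 \<omega>) / truncated_mean 1)"
    using L_integrable LX_integrable LR_integrable by simp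
  then show ?thesis
    by (simp add: algebra_simps)
qed

lemma integrable_window_sum:
  assumes "t \<ge> 1"
  shows "integrable M (\<lambda>\<omega>. window_sum t \<omega> / t)"
proof (rule Bochner_Integration.integrable_bound [OF integrable_window_bound])
  show "AE \<omega> in M. norm (window_sum t \<omega> / t) \<le>
      norm (real (L 1 \<omega>) * ((2 + X 1 \<omega> + cluster_radius L T 1 \<omega>) / truncated_mean 1))"
  proof (rule AE_I2)
    fix \<omega> assume "\<omega> \<in> space M"
    then have "window_sum t \<omega> / t \<le>
        real (L 1 \<omega>) * ((2 + X 1 \<omega> + cluster_radius L T 1 \<omega>) / truncated_mean 1)"
      by (rule window_sum_le [OF assms])
    moreover have "window_sum t \<omega> / t \<ge> 0"
      using assms by (intro divide_nonneg_nonneg window_sum_nonneg) auto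
    ultimately show "norm (window_sum t \<omega> / t) \<le>
        norm (real (L 1 \<omega>) * ((2 + X 1 \<omega> + cluster_radius L T 1 \<omega>) / truncated_mean 1))"
      unfolding real_norm_def by linarith
  qed
qed measurable

lemma expectation_window_sum_tendsto:
  "((\<lambda>t. expectation (\<lambda>\<omega>. window_sum t \<omega> / t)) \<longlongrightarrow>
    1 / expectation (X 1) * expectation (\<lambda>\<omega>. real (L 1 \<omega>))) at_top"
proof -
  have "((\<lambda>t. expectation (\<lambda>\<omega>. window_sum t \<omega> / t)) \<longlongrightarrow>
      expectation (\<lambda>\<omega>. real (L 1 \<omega>) * (1 / expectation (X 1)))) at_top"
  proof (rule integral_dominated_convergence_at_top [OF _ _ integrable_window_bound])
    show "AE \<omega> in M. ((\<lambda>t. window_sum t \<omega> / t) \<longlongrightarrow> real (L 1 \<omega>) * (1 / expectation (X 1))) at_top"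
    proof (rule AE_I2)
      fix \<omega>
      have "((\<lambda>t. \<Sum>j=1..L 1 \<omega>.
          (renewal_function (t - (X 1 \<omega> + T 1 j \<omega>)) - renewal_function (- (X 1 \<omega> + T 1 j \<omega>))) / t)
          \<longlongrightarrow> (\<Sum>j=1..L 1 \<omega>. 1 / expectation (X 1))) at_top"
        by (intro tendsto_sum renewal_window_tendsto)
      then show "((\<lambda>t. window_sum t \<omega> / t) \<longlongrightarrow> real (L 1 \<omega>) * (1 / expectation (X 1))) at_top"
        by (simp add: window_sum_def sum_divide_distrib)
    qed
    show "\<forall>\<^sub>F t in at_top. AE \<omega> in M. norm (window_sum t \<omega> / t) \<le>
        real (L 1 \<omega>) * ((2 + X 1 \<omega> + cluster_radius L T 1 \<omega>) / truncated_mean 1)"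
      using eventually_ge_at_top [of 1]
    proof eventually_elim
      case (elim t)
      then show ?case
        using window_sum_le [OF elim] window_sum_nonneg [of t] by (auto intro!: AE_I2)
    qed
  qed measurable
  then show ?thesis
    by (simp add: mult.commute)
qed

end

lemma initial_cluster_negligible:
  assumes "integrable M (\<lambda>\<omega>. real (L 0 \<omega>))"
  shows "((\<lambda>t. (\<integral>\<^sup>+ \<omega>. (\<Sum>j=1..L 0 \<omega>. indicator {0<..t} (S 0 \<omega> + T 0 j \<omega>)) \<partial>M) / ennreal t)
    \<longlongrightarrow> 0) at_top"
proof (rule tendsto_sandwich [where f = "\<lambda>_. 0"])
  let ?c = "expectation (\<lambda>\<omega>. real (L 0 \<omega>))"
  have bound: "(\<integral>\<^sup>+ \<omega>. (\<Sum>j=1..L 0 \<omega>. indicator {0<..t} (S 0 \<omega> + T 0 j \<omega>)) \<partial>M) \<le> ennreal ?c" for t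
  proof -
    have "(\<integral>\<^sup>+ \<omega>. (\<Sum>j=1..L 0 \<omega>. indicator {0<..t} (S 0 \<omega> + T 0 j \<omega>)) \<partial>M)
        \<le> (\<integral>\<^sup>+ \<omega>. ennreal (real (L 0 \<omega>)) \<partial>M)"
    proof (rule nn_integral_mono)
      fix \<omega>
      have "(\<Sum>j=1..L 0 \<omega>. indicator {0<..t} (S 0 \<omega> + T 0 j \<omega>) :: ennreal) \<le> (\<Sum>j=1..L 0 \<omega>. 1)"
        by (intro sum_mono) (auto simp: indicator_def)
      then show "(\<Sum>j=1..L 0 \<omega>. indicator {0<..t} (S 0 \<omega> + T 0 j \<omega>)) \<le> ennreal (real (L 0 \<omega>))"
        by (simp add: ennreal_of_nat_eq_real_of_nat)
    qed
    also have "\<dots> = ennreal ?c"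
      by (rule nn_integral_eq_integral [OF assms]) auto
    finally show ?thesis .
  qed
  show "\<forall>\<^sub>F t in at_top. (\<integral>\<^sup>+ \<omega>. (\<Sum>j=1..L 0 \<omega>. indicator {0<..t} (S 0 \<omega> + T 0 j \<omega>)) \<partial>M) / ennreal t
      \<le> ennreal (?c / t)"
    using eventually_gt_at_top [of 0]
  proof eventually_elim
    case (elim t)
    have "ennreal (?c / t) = ennreal ?c / ennreal t"
      using elim by (simp add: divide_ennreal)
    then show ?case
      using divide_right_mono_ennreal [OF bound [of t]] by simp
  qed
  have "((\<lambda>t::real. ?c / t) \<longlongrightarrow> 0) at_top"
    by (intro tendsto_divide_0 [OF tendsto_const] filterlim_at_top_imp_at_infinity filterlim_ident)
  from tendsto_ennrealI [OF this] show "((\<lambda>t. ennreal (?c / t)) \<longlongrightarrow> 0) at_top"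
    by simp
qed auto

end

theorem corollary3p8:
  fixes M :: "'a measure"
    and L :: "nat \<Rightarrow> 'a \<Rightarrow> nat"
    and T :: "nat \<Rightarrow> nat \<Rightarrow> 'a \<Rightarrow> real"
    and X :: "nat \<Rightarrow> 'a \<Rightarrow> real"
  assumes "renewal_cluster_process M L T X"
    and "integrable M (\<lambda>\<omega>. real (L 0 \<omega>))"
    and "integrable M (\<lambda>\<omega>. real (L 1 \<omega>))"
    and "integrable M (\<lambda>\<omega>. real (L 1 \<omega>) * X 1 \<omega>)"
    and "integrable M (\<lambda>\<omega>. real (L 1 \<omega>) * cluster_radius L T 1 \<omega>)"
  shows "((\<lambda>t::real. (\<integral>\<^sup>+ \<omega>. cluster_process L T X \<omega> {0<..t} \<partial>M) / ennreal t)
           \<longlongrightarrow> ennreal (1 / (\<integral>\<omega>. X 1 \<omega> \<partial>M) * (\<integral>\<omega>. real (L 1 \<omega>) \<partial>M))) at_top"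
proof -
  interpret renewal_cluster_process M L T X by fact
  let ?I = "\<lambda>t. \<integral>\<^sup>+ \<omega>. (\<Sum>j=1..L 0 \<omega>. indicator {0<..t} (S 0 \<omega> + T 0 j \<omega>)) \<partial>M"
  have "((\<lambda>t. ?I t / ennreal t + ennreal (expectation (\<lambda>\<omega>. window_sum t \<omega> / t)))
      \<longlongrightarrow> 0 + ennreal (1 / expectation (X 1) * expectation (\<lambda>\<omega>. real (L 1 \<omega>)))) at_top"
    by (intro tendsto_add initial_cluster_negligible tendsto_ennrealI
        expectation_window_sum_tendsto assms)
  moreover have "\<forall>\<^sub>F t in at_top. ?I t / ennreal t + ennreal (expectation (\<lambda>\<omega>. window_sum t \<omega> / t)) =
      (\<integral>\<^sup>+ \<omega>. cluster_process L T X \<omega> {0<..t} \<partial>M) / ennreal t"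
    using eventually_ge_at_top [of 1]
  proof eventually_elim
    case (elim t)
    have "ennreal (expectation (\<lambda>\<omega>. window_sum t \<omega> / t)) = (\<integral>\<^sup>+ \<omega>. ennreal (window_sum t \<omega> / t) \<partial>M)"
      using elim window_sum_nonneg [of t]
      by (intro nn_integral_eq_integral [symmetric] integrable_window_sum assms) auto
    also have "\<dots> = (\<integral>\<^sup>+ \<omega>. ennreal (window_sum t \<omega>) / ennreal t \<partial>M)"
      using elim window_sum_nonneg [of t] by (simp add: divide_ennreal)
    also have "\<dots> = (\<integral>\<^sup>+ \<omega>. ennreal (window_sum t \<omega>) \<partial>M) / ennreal t"
      by (rule nn_integral_divide) measurable
    finally show ?case
      using elim by (simp add: nn_integral_cluster_process add_divide_distrib_ennreal)
  qed
  ultimately show ?thesis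
    using Lim_transform_eventually by force
qed

end
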